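(* Let $G$ be a graph with a transitive decomposition $\{H_1,\dots,H_t\}$, let $c$ be a positive real number and let $\Sigma$ be an arbitrary surface. Then $\mathrm{cr}_{\Sigma}(G)\geq\lceil ct\rceil$ if and only if $\max\{l^D_c(H_1),\dots,l^D_c(H_t)\}\leq t$ for every good drawing $D$ of $G$ in $\Sigma$.
   Context: A drawing of a graph in a surface is good if no edge crosses itself, adjacent edges do not cross, no two edges cross more than once, and no three edges cross at a common point; $\mathrm{cr}_\Sigma(G)$ is the minimum number of crossings over all good drawings of $G$ in $\Sigma$. A decomposition of $G$ is a list of edge-disjoint subgraphs of $G$ such that every edge of $G$ lies in one of them. A decomposition $\{H_1,\dots,H_t\}$ of $G$ is transitive if for every pair $1\le i,j\le t$ there is an automorphism $\theta_{i,j}$ of $G$ such that $uv\in E(H_{i+\ell})$ iff $\theta_{i,j}(u)\theta_{i,j}(v)\in E(H_{j+\ell})$ for all $0\le \ell<t$ (subscripts modulo $t$). For edge-disjoint subgraphs $A,B$ of $G$ and a good drawing $D$, $\mathrm{cr}_D(A,B)$ is the number of crossings in $D$ between an edge of $A$ and an edge of $B$, and $\mathrm{cr}_D(A)$ is the number of crossings among edges of $A$. For a subgraph $H$ of $G$, $f_D(H)=\mathrm{cr}_D(H)+\mathrm{cr}_D(H,G\setminus E(H))/2$. For $j-i<t$, $H_{i,j}$ denotes $H_i\cup\dots\cup H_j$ with subscripts modulo $t$. For $c>0$ and $1\le i\le t$, $l^D_c(H_i)$ is the smallest positive integer $l\le t$ with $f_D(H_{i,i-1+l})\geq lc$ if such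 an integer exists, and $l^D_c(H_i)=t+1$ otherwise. *)

theory Defs
  imports "HOL-Analysis.Analysis" "HOL-Library.Extended_Nat"
begin

section \<open>Graphs and transitive decompositions\<close>

record 'v ugraph =
  verts :: "'v set"
  edges :: "'v set set"

definition simple_graph :: "'v ugraph \<Rightarrow> bool" where
  "simple_graph G \<longleftrightarrow> finite (verts G) \<and>
     (\<forall>e\<in>edges G. \<exists>u\<in>verts G. \<exists>v\<in>verts G. u \<noteq> v \<and> e = {u, v})"

definition subgraph :: "'v ugraph \<Rightarrow> 'v ugraph \<Rightarrow> bool" where
  "subgraph H G \<longleftrightarrow> simple_graph H \<and> verts H \<subseteq> verts G \<and> edges H \<subseteq> edges G"

definition delete_edges :: "'v ugraph \<Rightarrow> 'v set set \<Rightarrow> 'v ugraph" where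
  "delete_edges G F = \<lparr>verts = verts G, edges = edges G - F\<rparr>"

definition graph_automorphism :: "'v ugraph \<Rightarrow> ('v \<Rightarrow> 'v) \<Rightarrow> bool" where
  "graph_automorphism G \<theta> \<longleftrightarrow> bij_betw \<theta> (verts G) (verts G) \<and>
     (\<forall>u\<in>verts G. \<forall>v\<in>verts G. {u, v} \<in> edges G \<longleftrightarrow> {\<theta> u, \<theta> v} \<in> edges G)"

text \<open>The representative of \<open>k\<close> modulo \<open>t\<close> in \<open>{1..t}\<close>.\<close>

definition cyc :: "nat \<Rightarrow> nat \<Rightarrow> nat" where
  "cyc t k = (if k mod t = 0 then t else k mod t)"

text \<open>A decomposition into \<open>t\<close> subgraphs is the family \<open>H 1, \<dots>, H t\<close>; the values of \<open>H\<close>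
  outside \<open>{1..t}\<close> are irrelevant.\<close>

definition decomposition :: "'v ugraph \<Rightarrow> nat \<Rightarrow> (nat \<Rightarrow> 'v ugraph) \<Rightarrow> bool" where
  "decomposition G t H \<longleftrightarrow>
     (\<forall>i\<in>{1..t}. subgraph (H i) G) \<and>
     (\<forall>i\<in>{1..t}. \<forall>j\<in>{1..t}. i \<noteq> j \<longrightarrow> edges (H i) \<inter> edges (H j) = {}) \<and>
     (\<forall>e\<in>edges G. \<exists>i\<in>{1..t}. e \<in> edges (H i))"

definition transitive_decomposition :: "'v ugraph \<Rightarrow> nat \<Rightarrow> (nat \<Rightarrow> 'v ugraph) \<Rightarrow> bool" where
  "transitive_decomposition G t H \<longleftrightarrow> decomposition G t H \<and>
     (\<forall>i\<in>{1..t}. \<forall>j\<in>{1..t}. \<exists>\<theta>. graph_automorphism G \<theta> \<and>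
        (\<forall>l<t. \<forall>u\<in>verts G. \<forall>v\<in>verts G.
           {u, v} \<in> edges (H (cyc t (i + l))) \<longleftrightarrow> {\<theta> u, \<theta> v} \<in> edges (H (cyc t (j + l)))))"

definition segment_union :: "nat \<Rightarrow> (nat \<Rightarrow> 'v ugraph) \<Rightarrow> nat \<Rightarrow> nat \<Rightarrow> 'v ugraph" where
  "segment_union t H i j =
     \<lparr>verts = (\<Union>k\<in>{i..j}. verts (H (cyc t k))), edges = (\<Union>k\<in>{i..j}. edges (H (cyc t k)))\<rparr>"

section \<open>Surfaces and drawings\<close>

definition surface :: "'a topology \<Rightarrow> bool" where
  "surface X \<longleftrightarrow> topspace X \<noteq> {} \<and> connected_space X \<and> Hausdorff_space X \<and> second_countable X \<and>
     (\<forall>x\<in>topspace X. \<exists>U. openin X U \<and> x \<in> U \<and>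
        subtopology X U homeomorphic_space (euclidean :: (real^2) topology))"

text \<open>The curves \<open>g\<close> at parameter \<open>s\<close> and \<open>g'\<close> at parameter \<open>s'\<close> pass through the same point,
  and some chart around it carries the two local branches to the two coordinate axes. This is
  the topological form of a transversal crossing; it excludes tangential contact.\<close>

definition transversal_at ::
  "'a topology \<Rightarrow> (real \<Rightarrow> 'a) \<Rightarrow> real \<Rightarrow> (real \<Rightarrow> 'a) \<Rightarrow> real \<Rightarrow> bool" where
  "transversal_at X g s g' s' \<longleftrightarrow> g s = g' s' \<and>
     (\<exists>U (h :: 'a \<Rightarrow> real^2) a b a' b'.
        openin X U \<and> homeomorphic_map (subtopology X U) euclidean h \<and>
        s \<in> {a<..<b} \<and> {a<..<b} \<subseteq> {0..1} \<and> g ` {a<..<b} \<subseteq> U \<and>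
        s' \<in> {a'<..<b'} \<and> {a'<..<b'} \<subseteq> {0..1} \<and> g' ` {a'<..<b'} \<subseteq> U \<and>
        bij_betw (h \<circ> g) {a<..<b} {x. x $ 2 = 0} \<and>
        bij_betw (h \<circ> g') {a'<..<b'} {x. x $ 1 = 0})"

record ('v, 'a) drawing =
  vpoint :: "'v \<Rightarrow> 'a"
  ecurve :: "'v set \<Rightarrow> real \<Rightarrow> 'a"

text \<open>Vertices are distinct points, an edge is a curve between its ends whose interior avoids
  all vertices, and whenever two edge interiors (or two different parts of one edge interior)
  meet, they cross there.\<close>

definition is_drawing :: "'a topology \<Rightarrow> 'v ugraph \<Rightarrow> ('v, 'a) drawing \<Rightarrow> bool" where
  "is_drawing X G D \<longleftrightarrow>
     inj_on (vpoint D) (verts G) \<and> vpoint D ` verts G \<subseteq> topspace X \<and>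
     (\<forall>e\<in>edges G. pathin X (ecurve D e) \<and> {ecurve D e 0, ecurve D e 1} = vpoint D ` e \<and>
        ecurve D e ` {0<..<1} \<inter> vpoint D ` verts G = {}) \<and>
     (\<forall>e\<in>edges G. \<forall>f\<in>edges G. \<forall>s\<in>{0<..<1}. \<forall>s'\<in>{0<..<1}.
        (e, s) \<noteq> (f, s') \<and> ecurve D e s = ecurve D f s' \<longrightarrow>
        transversal_at X (ecurve D e) s (ecurve D f) s')"

text \<open>Edges \<open>e\<close> and \<open>f\<close> cross at \<open>p\<close> (for \<open>e = f\<close>: a self-crossing). Transversality need not be
  repeated here, as it is part of \<^const>\<open>is_drawing\<close>.\<close>

definition cross_at :: "('v, 'a) drawing \<Rightarrow> 'v set \<Rightarrow> 'v set \<Rightarrow> 'a \<Rightarrow> bool" where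
  "cross_at D e f p \<longleftrightarrow> (\<exists>s\<in>{0<..<1}. \<exists>s'\<in>{0<..<1}.
     (e, s) \<noteq> (f, s') \<and> ecurve D e s = p \<and> ecurve D f s' = p)"

definition good_drawing :: "'a topology \<Rightarrow> 'v ugraph \<Rightarrow> ('v, 'a) drawing \<Rightarrow> bool" where
  "good_drawing X G D \<longleftrightarrow> is_drawing X G D \<and>
     (\<forall>e\<in>edges G. \<not> (\<exists>p. cross_at D e e p)) \<and>
     (\<forall>e\<in>edges G. \<forall>f\<in>edges G. e \<noteq> f \<and> e \<inter> f \<noteq> {} \<longrightarrow> \<not> (\<exists>p. cross_at D e f p)) \<and>
     (\<forall>e\<in>edges G. \<forall>f\<in>edges G. e \<noteq> f \<longrightarrow>
        (\<forall>p q. cross_at D e f p \<and> cross_at D e f q \<longrightarrow> p = q)) \<and>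
     (\<forall>e\<in>edges G. \<forall>f\<in>edges G. \<forall>g\<in>edges G. e \<noteq> f \<and> f \<noteq> g \<and> e \<noteq> g \<longrightarrow>
        \<not> (\<exists>p. cross_at D e f p \<and> cross_at D f g p \<and> cross_at D e g p))"

section \<open>Counting crossings\<close>

text \<open>In a good drawing a crossing point determines the two edges crossing there, so crossings
  are counted as points.\<close>

definition cr_between :: "('v, 'a) drawing \<Rightarrow> 'v ugraph \<Rightarrow> 'v ugraph \<Rightarrow> nat" where
  "cr_between D A B = card {p. \<exists>e\<in>edges A. \<exists>f\<in>edges B. cross_at D e f p}"

definition cr_within :: "('v, 'a) drawing \<Rightarrow> 'v ugraph \<Rightarrow> nat" where
  "cr_within D A = card {p. \<exists>e\<in>edges A. \<exists>f\<in>edges A. cross_at D e f p}"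

text \<open>An infimum of naturals in \<^typ>\<open>enat\<close> is the minimum whenever a good drawing exists.\<close>

definition crossing_number :: "'a topology \<Rightarrow> 'v ugraph \<Rightarrow> enat" where
  "crossing_number X G = (INF D\<in>{D :: ('v, 'a) drawing. good_drawing X G D}. enat (cr_within D G))"

definition f_val :: "'v ugraph \<Rightarrow> ('v, 'a) drawing \<Rightarrow> 'v ugraph \<Rightarrow> real" where
  "f_val G D H = real (cr_within D H) + real (cr_between D H (delete_edges G (edges H))) / 2"

definition l_val ::
  "'v ugraph \<Rightarrow> nat \<Rightarrow> (nat \<Rightarrow> 'v ugraph) \<Rightarrow> real \<Rightarrow> ('v, 'a) drawing \<Rightarrow> nat \<Rightarrow> nat" where
  "l_val G t H c D i =
     (let P = (\<lambda>l. 1 \<le> l \<and> l \<le> t \<and> f_val G D (segment_union t H i (i - 1 + l)) \<ge> real l * c)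
      in if \<exists>l. P l then (LEAST l. P l) else t + 1)"

end

theory Submission
  imports Defs
begin

text \<open>In a good drawing every crossing lies on exactly two edges, so \<open>f\<^sub>D(A)\<close> is the sum, over all
  crossings, of half the number of edges of \<open>A\<close> through the crossing. Hence \<open>f\<^sub>D\<close> is additive over
  edge-disjoint subgraphs, and the theorem becomes a statement about the cyclic sequence
  \<open>a\<^sub>k = f\<^sub>D(H\<^sub>k)\<close>, whose total is the number of crossings of \<open>D\<close>. If the total is less than
  \<open>ct\<close>, then the partial sums of \<open>a\<^sub>k - c\<close> drop over each period; starting just after their last
  maximum within one period, no block of length at most \<open>t\<close> has average \<open>c\<close> or more.\<close>

section \<open>Crossings as double points, and additivity of \<open>f_val\<close>\<close>

definition edges_through :: "'v ugraph \<Rightarrow> ('v, 'a) drawing \<Rightarrow> 'a \<Rightarrow> 'v set set" where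
  "edges_through G D p = {e \<in> edges G. p \<in> ecurve D e ` {0<..<1}}"

definition crossings :: "'v ugraph \<Rightarrow> ('v, 'a) drawing \<Rightarrow> 'a set" where
  "crossings G D = {p. \<exists>e\<in>edges G. \<exists>f\<in>edges G. cross_at D e f p}"

lemma finite_edges_simple_graph:
  assumes "simple_graph G"
  shows "finite (edges G)"
proof (rule finite_subset)
  show "edges G \<subseteq> Pow (verts G)"
    using assms by (auto simp: simple_graph_def)
  show "finite (Pow (verts G))"
    using assms by (simp add: simple_graph_def)
qed

text \<open>For distinct edges the condition on the pairs (edge, parameter) in
  \<open>cross_at\<close> is automatic, so crossing at \<open>p\<close> only means that both
  interiors contain \<open>p\<close>. For equal edges both sides are false, since good drawings have
  no self-crossings.\<close>

lemma good_drawing_cross_at_iff: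
  assumes "good_drawing X G D" "e \<in> edges G" "f \<in> edges G"
  shows "cross_at D e f p \<longleftrightarrow> e \<noteq> f \<and> e \<in> edges_through G D p \<and> f \<in> edges_through G D p"
proof (cases "e = f")
  case True
  then show ?thesis
    using assms(1,2) by (auto simp: good_drawing_def)
next
  case False
  then have "cross_at D e f p \<longleftrightarrow>
      (\<exists>s\<in>{0<..<1}. ecurve D e s = p) \<and> (\<exists>s\<in>{0<..<1}. ecurve D f s = p)"
    by (simp add: cross_at_def)
  also have "\<dots> \<longleftrightarrow> p \<in> ecurve D e ` {0<..<1} \<and> p \<in> ecurve D f ` {0<..<1}"
    by (simp only: image_iff eq_commute[of p])
  finally show ?thesis
    using assms(2,3) False by (simp add: edges_through_def)
qed

text \<open>Each of the finitely many pairs of edges contributes at most one point. Finiteness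
  allows the counts by \<open>card\<close> to be written as sums over the crossings.\<close>

lemma finite_crossings:
  assumes "good_drawing X G D" "finite (edges G)"
  shows "finite (crossings G D)"
proof -
  have "finite {p. cross_at D e f p}" if ef: "e \<in> edges G" "f \<in> edges G" for e f
  proof (cases "e = f")
    case True
    then have "{p. cross_at D e f p} = {}"
      using assms(1) ef by (auto simp: good_drawing_def)
    then show ?thesis by simp
  next
    case False
    have uniq: "p = q" if "cross_at D e f p" "cross_at D e f q" for p q
      using assms(1) ef False that unfolding good_drawing_def by blast
    show ?thesis
    proof (cases "\<exists>p. cross_at D e f p")
      case True
      then obtain p where "cross_at D e f p" by blast
      then have "{p. cross_at D e f p} \<subseteq> {p}" using uniq by blast
      then show ?thesis by (rule finite_subset) simp
    qed simp
  qed
  moreover have "crossings G D = (\<Union>e\<in>edges G. \<Union>f\<in>edges G. {p. cross_at D e f p})"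
    by (auto simp: crossings_def)
  ultimately show ?thesis
    using assms(2) by simp
qed

lemma edges_through_crossing:
  assumes "good_drawing X G D" "p \<in> crossings G D"
  obtains e f where "e \<noteq> f" "edges_through G D p = {e, f}"
proof -
  obtain e f where ef: "e \<in> edges G" "f \<in> edges G" "cross_at D e f p"
    using assms(2) by (auto simp: crossings_def)
  then have ne: "e \<noteq> f" and thr: "e \<in> edges_through G D p" "f \<in> edges_through G D p"
    using good_drawing_cross_at_iff[OF assms(1)] by blast+
  \<comment> \<open>A third edge through \<open>p\<close> would cross both \<open>e\<close> and
    \<open>f\<close> there, giving a forbidden triple crossing.\<close>
  have "g = e \<or> g = f" if g: "g \<in> edges_through G D p" for g
  proof (rule ccontr)
    assume "\<not> (g = e \<or> g = f)"
    moreover have "g \<in> edges G" using g by (simp add: edges_through_def)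
    ultimately have "cross_at D f g p" "cross_at D e g p"
      using good_drawing_cross_at_iff[OF assms(1)] ef thr g by blast+
    moreover have "\<not> (\<exists>p. cross_at D e f p \<and> cross_at D f g p \<and> cross_at D e g p)"
      using assms(1) ef \<open>g \<in> edges G\<close> ne \<open>\<not> (g = e \<or> g = f)\<close>
      unfolding good_drawing_def by metis
    ultimately show False using ef by blast
  qed
  then have "edges_through G D p = {e, f}" using thr by blast
  then show ?thesis using that ne by blast
qed

text \<open>A crossing with both edges in \<open>A\<close> adds 1 through \<open>cr_within\<close>;
  one with exactly one edge in \<open>A\<close> adds 1/2 through \<open>cr_between\<close>. Either
  way this is half the number of edges of \<open>A\<close> through it.\<close>

lemma f_val_eq_sum_crossings:
  assumes good: "good_drawing X G D" and fin: "finite (edges G)" and sub: "edges A \<subseteq> edges G"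
  shows "f_val G D A = (\<Sum>p\<in>crossings G D. real (card (edges_through G D p \<inter> edges A)) / 2)"
proof -
  let ?C = "crossings G D"
  let ?within = "{p. \<exists>e\<in>edges A. \<exists>f\<in>edges A. cross_at D e f p}"
  let ?between = "{p. \<exists>e\<in>edges A. \<exists>f\<in>edges (delete_edges G (edges A)). cross_at D e f p}"
  have finC: "finite ?C" using finite_crossings[OF good fin] .
  have subs: "?within \<subseteq> ?C" "?between \<subseteq> ?C"
    using sub by (auto simp: crossings_def delete_edges_def)
  \<comment> \<open>Both cardinalities become indicator sums over the same finite set, so it
    suffices to compare the contributions of a single crossing.\<close>
  have count: "real (card S) = (\<Sum>p\<in>?C. of_bool (p \<in> S))" if "S \<subseteq> ?C" for S
    using that finC by (simp add: Int_absorb1 flip: of_nat_sum)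
  have "of_bool (p \<in> ?within) + of_bool (p \<in> ?between) / 2
      = real (card (edges_through G D p \<inter> edges A)) / 2" if p: "p \<in> ?C" for p
  proof -
    obtain e f where ef: "e \<noteq> f" "edges_through G D p = {e, f}"
      using edges_through_crossing[OF good p] .
    have cross: "cross_at D e' f' p \<longleftrightarrow> e' \<noteq> f' \<and> e' \<in> {e, f} \<and> f' \<in> {e, f}"
      if "e' \<in> edges G" "f' \<in> edges G" for e' f'
      using good_drawing_cross_at_iff[OF good that] ef by simp
    have inG: "e \<in> edges G" "f \<in> edges G"
      using ef by (auto simp: edges_through_def)
    have "p \<in> ?within \<longleftrightarrow> e \<in> edges A \<and> f \<in> edges A"
      using cross sub ef(1) by blast
    moreover have "p \<in> ?between \<longleftrightarrow> (e \<in> edges A) \<noteq> (f \<in> edges A)"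
    proof -
      have "p \<in> ?between \<longleftrightarrow> (\<exists>e'\<in>edges A. \<exists>f'\<in>edges G - edges A. cross_at D e' f' p)"
        by (simp add: delete_edges_def)
      also have "\<dots> \<longleftrightarrow> (\<exists>e'\<in>edges A. \<exists>f'\<in>edges G - edges A. e' \<in> {e, f} \<and> f' \<in> {e, f})"
      proof (intro bex_cong refl)
        fix e' f' assume "e' \<in> edges A" "f' \<in> edges G - edges A"
        then show "cross_at D e' f' p \<longleftrightarrow> e' \<in> {e, f} \<and> f' \<in> {e, f}"
          using cross[of e' f'] sub by auto
      qed
      finally show ?thesis using inG by blast
    qed
    moreover have "card (edges_through G D p \<inter> edges A)
        = of_bool (e \<in> edges A) + of_bool (f \<in> edges A)"
      using ef by (auto simp: Int_insert_left)
    ultimately show ?thesis by (simp only:) (auto simp: of_bool_def)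
  qed
  then have "(\<Sum>p\<in>?C. of_bool (p \<in> ?within) + of_bool (p \<in> ?between) / 2)
      = (\<Sum>p\<in>?C. real (card (edges_through G D p \<inter> edges A)) / 2)"
    by (intro sum.cong refl)
  then show ?thesis
    unfolding f_val_def cr_within_def cr_between_def count[OF subs(1)] count[OF subs(2)]
    by (simp only: sum.distrib sum_divide_distrib)
qed

text \<open>At each crossing the number of edges through it is additive over the disjoint edge sets;
  exchanging the two sums gives the claim.\<close>

lemma f_val_UN_disjoint:
  assumes "good_drawing X G D" "finite (edges G)" "finite I"
    and "\<And>i. i \<in> I \<Longrightarrow> edges (B i) \<subseteq> edges G"
    and "\<And>i j. i \<in> I \<Longrightarrow> j \<in> I \<Longrightarrow> i \<noteq> j \<Longrightarrow> edges (B i) \<inter> edges (B j) = {}"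
    and "edges A = (\<Union>i\<in>I. edges (B i))"
  shows "f_val G D A = (\<Sum>i\<in>I. f_val G D (B i))"
proof -
  let ?E = "edges_through G D"
  have "card (?E p \<inter> edges A) = (\<Sum>i\<in>I. card (?E p \<inter> edges (B i)))" for p
  proof -
    have "finite (?E p)"
      using assms(2) by (simp add: edges_through_def)
    then have "card (\<Union>i\<in>I. ?E p \<inter> edges (B i)) = (\<Sum>i\<in>I. card (?E p \<inter> edges (B i)))"
      using assms(3,5) by (intro card_UN_disjoint) auto
    then show ?thesis by (simp add: assms(6))
  qed
  moreover have "edges A \<subseteq> edges G" using assms(4,6) by auto
  ultimately have "f_val G D A
      = (\<Sum>p\<in>crossings G D. \<Sum>i\<in>I. real (card (?E p \<inter> edges (B i))) / 2)"
    by (simp add: f_val_eq_sum_crossings[OF assms(1,2)] sum_divide_distrib)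
  also have "\<dots> = (\<Sum>i\<in>I. f_val G D (B i))"
    by (subst sum.swap) (simp add: f_val_eq_sum_crossings[OF assms(1,2)] assms(4))
  finally show ?thesis .
qed

lemma f_val_spanning:
  assumes "edges A = edges G"
  shows "f_val G D A = real (cr_within D G)"
  using assms by (simp add: f_val_def cr_within_def cr_between_def delete_edges_def)

section \<open>Indices modulo \<open>t\<close> and blocks of consecutive subgraphs\<close>

lemma cyc_in_range: "1 \<le> t \<Longrightarrow> cyc t k \<in> {1..t}"
  by (auto simp: cyc_def intro: order.strict_implies_order)

lemma cyc_cong_iff:
  assumes "1 \<le> t"
  shows "cyc t j = cyc t k \<longleftrightarrow> j mod t = k mod t"
proof -
  have "(if x = 0 then t else x) = (if y = 0 then t else y) \<longleftrightarrow> x = y" if "x < t" "y < t" for x y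
    using that by auto
  then show ?thesis using assms by (simp add: cyc_def)
qed

text \<open>Indices with the same representative differ by a multiple of \<open>t\<close>, while two
  indices in a window of length at most \<open>t\<close> differ by less than
  \<open>t\<close>.\<close>

lemma inj_on_cyc:
  assumes "1 \<le> t" "l \<le> t"
  shows "inj_on (cyc t) {i..<i + l}"
proof -
  have "j = k" if "j \<le> k" "j \<in> {i..<i + l}" "k \<in> {i..<i + l}" "cyc t j = cyc t k" for j k
  proof -
    have "t dvd k - j"
      using that assms by (metis cyc_cong_iff mod_eq_dvd_iff_nat)
    moreover have "k - j < t" using that assms by auto
    ultimately have "k - j = 0" by (metis nat_dvd_not_less neq0_conv)
    then show ?thesis using that by simp
  qed
  then show ?thesis by (intro inj_onI) (metis nat_le_linear)
qed

lemma cyc_image_period: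
  assumes "1 \<le> t"
  shows "cyc t ` {i..<i + t} = {1..t}"
  using cyc_in_range[OF assms] inj_on_cyc[OF assms order_refl, of i]
  by (intro card_subset_eq) (auto simp: card_image)

lemma decomposition_edges_Un:
  assumes "decomposition G t H"
  shows "(\<Union>i\<in>{1..t}. edges (H i)) = edges G"
  using assms by (fastforce simp: decomposition_def subgraph_def)

text \<open>As \<open>l\<close> is at most \<open>t\<close>, the block runs through pairwise
  different members of the decomposition, so additivity applies.\<close>

lemma f_val_segment_union:
  assumes "good_drawing X G D" "finite (edges G)" "decomposition G t H"
    and "1 \<le> t" "1 \<le> i" "l \<le> t"
  shows "f_val G D (segment_union t H i (i - 1 + l)) = (\<Sum>k\<in>{i..<i + l}. f_val G D (H (cyc t k)))"
proof (rule f_val_UN_disjoint[OF assms(1,2)])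
  show "edges (H (cyc t k)) \<subseteq> edges G" for k
    using assms(3) cyc_in_range[OF assms(4), of k] by (auto simp: decomposition_def subgraph_def)
  show "edges (H (cyc t j)) \<inter> edges (H (cyc t k)) = {}"
    if "j \<in> {i..<i + l}" "k \<in> {i..<i + l}" "j \<noteq> k" for j k
  proof -
    have "cyc t j \<noteq> cyc t k"
      using inj_on_cyc[OF assms(4,6)] that by (meson inj_onD)
    then show ?thesis
      using assms(3) cyc_in_range[OF assms(4)] unfolding decomposition_def by blast
  qed
  have "{i..i - 1 + l} = {i..<i + l}" using assms(5) by auto
  then show "edges (segment_union t H i (i - 1 + l)) = (\<Union>k\<in>{i..<i + l}. edges (H (cyc t k)))"
    by (simp add: segment_union_def)
qed simp

section \<open>From averages of blocks to the total number of crossings\<close>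

lemma l_val_le_iff:
  "l_val G t H c D i \<le> t \<longleftrightarrow>
    (\<exists>l\<in>{1..t}. real l * c \<le> f_val G D (segment_union t H i (i - 1 + l)))"
proof -
  let ?P = "\<lambda>l. 1 \<le> l \<and> l \<le> t \<and> f_val G D (segment_union t H i (i - 1 + l)) \<ge> real l * c"
  have "(LEAST l. ?P l) \<le> t" if "\<exists>l. ?P l"
    using LeastI_ex[OF that] by blast
  \<comment> \<open>The default value \<open>t + 1\<close> exceeds \<open>t\<close>, so the bound
    holds only if some length qualifies.\<close>
  then show ?thesis by (auto simp: l_val_def Let_def)
qed

text \<open>A real-valued relative of the cycle lemma, proved by contradiction: if the total were
  too small, some starting point would admit no good block.\<close>

lemma cyclic_sum_ge_if_blocks_ge:
  fixes a :: "nat \<Rightarrow> real"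
  assumes t: "1 \<le> t" and per: "\<And>k. a (k + t) = a k"
    and blocks: "\<And>i. i < t \<Longrightarrow> \<exists>l\<in>{1..t}. real l * c \<le> sum a {i..<i + l}"
  shows "real t * c \<le> sum a {..<t}"
proof (rule ccontr)
  assume less: "\<not> real t * c \<le> sum a {..<t}"
  define B where "B n = sum a {..<n} - real n * c" for n
  have B_block: "B (i + l) = B i + (sum a {i..<i + l} - real l * c)" for i l
    by (simp add: B_def algebra_simps sum.atLeastLessThan_concat[symmetric, of 0 i "i + l"]
        flip: atLeast0LessThan)
  have drop: "B (n + t) < B n" for n
  proof -
    have "sum a {..<n + t} = sum a {..<n} + sum a {..<t}"
      by (induction n) (simp_all add: per)
    then show ?thesis using less by (simp add: B_def algebra_simps)
  qed
  define m where "m = Max (B ` {..<t})"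
  \<comment> \<open>Taking the last maximiser makes every later value of \<open>B\<close> within the
    period strictly smaller than \<open>m\<close>.\<close>
  define i where "i = Max {n \<in> {..<t}. B n = m}"
  have "m \<in> B ` {..<t}"
    unfolding m_def using t by (intro Max_in) (auto simp: lessThan_empty_iff)
  then have "i \<in> {n \<in> {..<t}. B n = m}"
    unfolding i_def by (intro Max_in) auto
  then have i: "i < t" "B i = m" by auto
  have le_m: "B n \<le> m" if "n < t" for n
    unfolding m_def using that by (intro Max_ge) auto
  have last: "B n < m" if "n < t" "i < n" for n
  proof -
    have "B n \<noteq> m"
    proof
      assume "B n = m"
      then have "n \<le> i" unfolding i_def using that by (intro Max_ge) auto
      then show False using that by simp
    qed
    then show ?thesis using le_m[OF that(1)] by simp
  qed
  obtain l where l: "l \<in> {1..t}" "real l * c \<le> sum a {i..<i + l}"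
    using blocks[OF i(1)] by blast
  have "B (i + l) < m"
  proof (cases "i + l < t")
    case True
    then show ?thesis using last l by simp
  next
    case False
    \<comment> \<open>A block that leaves the period is moved back by \<open>t\<close>. The strict
      inequality now comes from \<open>drop\<close>, and \<open>i + l - t\<close> is below
      \<open>t\<close>, where \<open>m\<close> is an upper bound.\<close>
    then have "B (i + l) < B (i + l - t)" using drop[of "i + l - t"] by simp
    also have "\<dots> \<le> m" using i l by (intro le_m) auto
    finally show ?thesis .
  qed
  \<comment> \<open>The chosen block has average at least \<open>c\<close>, so
    \<open>B (i + l)\<close> is at least \<open>B i = m\<close>.\<close>
  then show False using B_block[of i l] l i by simp
qed

text \<open>A block of length \<open>t\<close> contains all edges, so its \<open>f_val\<close> is
  the crossing count: this gives the forward direction with \<open>l = t\<close>. The converse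
  applies the cyclic lemma to the values of \<open>f_val\<close> on the members.\<close>

lemma crossings_ge_iff_l_val_le:
  assumes good: "good_drawing X G D" and fin: "finite (edges G)"
    and dec: "decomposition G t H" and t: "1 \<le> t"
  shows "real t * c \<le> real (cr_within D G) \<longleftrightarrow> (\<forall>i\<in>{1..t}. l_val G t H c D i \<le> t)"
proof
  have total: "f_val G D (segment_union t H i (i - 1 + t)) = real (cr_within D G)"
    if "1 \<le> i" for i
  proof (rule f_val_spanning)
    have "{i..i - 1 + t} = {i..<i + t}" using that by auto
    then have "edges (segment_union t H i (i - 1 + t)) = (\<Union>k\<in>cyc t ` {i..<i + t}. edges (H k))"
      by (simp add: segment_union_def)
    then show "edges (segment_union t H i (i - 1 + t)) = edges G"
      using cyc_image_period[OF t] decomposition_edges_Un[OF dec] by simp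
  qed
  {
    assume "real t * c \<le> real (cr_within D G)"
    then have "real t * c \<le> f_val G D (segment_union t H i (i - 1 + t))" if "i \<in> {1..t}" for i
      using total that by simp
    then show "\<forall>i\<in>{1..t}. l_val G t H c D i \<le> t"
      using t unfolding l_val_le_iff by (meson atLeastAtMost_iff order_refl)
  next
    assume short: "\<forall>i\<in>{1..t}. l_val G t H c D i \<le> t"
    \<comment> \<open>The shift by \<open>Suc\<close> passes from members numbered from 1 to a
      sequence starting at 0.\<close>
    define a where "a k = f_val G D (H (cyc t (Suc k)))" for k
    have seg: "f_val G D (segment_union t H (Suc i) (Suc i - 1 + l)) = sum a {i..<i + l}"
      if "l \<le> t" for i l
      using f_val_segment_union[OF good fin dec t _ that, of "Suc i"]
      by (simp add: a_def sum.shift_bounds_Suc_ivl del: sum.op_ivl_Suc)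
    have "real t * c \<le> sum a {..<t}"
    proof (rule cyclic_sum_ge_if_blocks_ge[OF t])
      have "cyc t (Suc (k + t)) = cyc t (Suc k)" for k
        using t by (simp add: cyc_def flip: add_Suc)
      then show "a (k + t) = a k" for k by (simp add: a_def)
      fix i assume "i < t"
      then have "l_val G t H c D (Suc i) \<le> t" using short by simp
      then show "\<exists>l\<in>{1..t}. real l * c \<le> sum a {i..<i + l}"
        unfolding l_val_le_iff using seg by fastforce
    qed
    then show "real t * c \<le> real (cr_within D G)"
      using seg[of t 0] total[of 1] by (simp add: atLeast0LessThan)
  }
qed

theorem theorem1:
  fixes G :: "'v ugraph" and H :: "nat \<Rightarrow> 'v ugraph" and t :: nat
    and c :: real and \<Sigma> :: "'a topology"
  assumes "simple_graph G"
    and "1 \<le> t"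
    and "transitive_decomposition G t H"
    and "0 < c"
    and "surface \<Sigma>"
  shows "enat (nat \<lceil>c * real t\<rceil>) \<le> crossing_number \<Sigma> G \<longleftrightarrow>
    (\<forall>D :: ('v, 'a) drawing. good_drawing \<Sigma> G D \<longrightarrow>
       Max ((\<lambda>i. l_val G t H c D i) ` {1..t}) \<le> t)"
proof -
  have dec: "decomposition G t H"
    using assms(3) by (simp add: transitive_decomposition_def)
  have "nat \<lceil>c * real t\<rceil> \<le> cr_within D G \<longleftrightarrow> Max ((\<lambda>i. l_val G t H c D i) ` {1..t}) \<le> t"
    if "good_drawing \<Sigma> G D" for D :: "('v, 'a) drawing"
  proof -
    have "nat \<lceil>c * real t\<rceil> \<le> cr_within D G \<longleftrightarrow> real t * c \<le> real (cr_within D G)"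
      by (simp add: nat_le_iff ceiling_le_iff mult.commute)
    also have "\<dots> \<longleftrightarrow> (\<forall>i\<in>{1..t}. l_val G t H c D i \<le> t)"
      using crossings_ge_iff_l_val_le[OF that finite_edges_simple_graph[OF assms(1)] dec assms(2)] .
    also have "\<dots> \<longleftrightarrow> Max ((\<lambda>i. l_val G t H c D i) ` {1..t}) \<le> t"
      using assms(2) by (subst Max_le_iff) auto
    finally show ?thesis .
  qed
  \<comment> \<open>A bound lies below an infimum iff it lies below every member. If there is no
    good drawing, the infimum is infinite and both sides hold.\<close>
  then show ?thesis
    by (auto simp: crossing_number_def le_INF_iff)
qed

end
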